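(* Let $T$ be a standard type theory. If $T$ derives an object judgement $\Theta;\Gamma\vdash\mathcal J$ (of the form $A\ \mathsf{type}$, $t:A$, or an abstraction thereof), then it does so by a derivation which concludes with precisely one of the following rules: (1) the variable rule; (2) the metavariable rule; (3) an instantiation of a symbol rule (a specific rule of $T$); (4) the abstraction rule; (5) the term conversion rule in the form: from $\Theta;\Gamma\vdash t:\tau_{\Theta;\Gamma}(t)$ and $\Theta;\Gamma\vdash\tau_{\Theta;\Gamma}(t)\equiv A$ infer $\Theta;\Gamma\vdash t:A$, where $\tau_{\Theta;\Gamma}(t)\neq A$.
   Context: Natural type (for a standard theory $T$ and context $\Theta;\Gamma$): $\tau_{\Theta;\Gamma}(a)=\Gamma(a)$; $\tau_{\Theta;\Gamma}(M(\vec t))=B[\vec t/\vec x]$ where $\Theta(M)=\{\vec x{:}\vec A\}\,\Box:B$; $\tau_{\Theta;\Gamma}(S(\vec e))=\langle\vec M\mapsto\vec e\rangle_*B$ where the rule of $T$ associated with $S$ is $[\vec M{:}\vec{\mathcal B}]\Longrightarrow S(\dots):B$. Standard theories: given a raw rule-boundary $\Xi\Longrightarrow\beta$ (i.e. a metavariable context $\Xi=[M_1{:}\mathcal B_1,\dots,M_n{:}\mathcal B_n]$ and a closed boundary thesis $\beta$ over it) with $\beta$ a type or term boundary of class $c$, and a symbol $S$ with arity $(c,[\mathrm{ar}(\mathcal B_1),\dots,\mathrm{ar}(\mathcal B_n)])$, the associated symbol rule is $\Xi\Longrightarrow\beta[S(\hat M_1,\dots,\hat M_n)]$, where $\hat M_i=\{x_1\}\cdots\{x_k\}M_i(x_1,\dots,x_k)$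 if $\mathrm{ar}(\mathcal B_i)=(c',k)$ with $c'\in\{\mathrm{Ty},\mathrm{Tm}\}$, and $\hat M_i=\{x_1\}\cdots\{x_k\}\star$ otherwise. A raw rule $\Xi\Longrightarrow\beta[e]$ is finitary over a raw theory $T'$ if $\vdash_{T'}\Xi\ \mathsf{mctx}$ and $\Xi;[]\vdash_{T'}\beta$; a raw theory $(R_i)_{i\in I}$ is finitary if there is a well-founded order $\prec$ on $I$ with each $R_i$ finitary over $(R_j)_{j\prec i}$. A finitary theory is standard if each of its specific object rules is a symbol rule and each symbol has precisely one associated rule. Well-formed contexts: $\vdash_T[]\ \mathsf{mctx}$; $\vdash_T[\Theta,M{:}\mathcal B]\ \mathsf{mctx}$ if $\vdash_T\Theta\ \mathsf{mctx}$, $\Theta;[]\vdash_T\mathcal B$ and $M\notin|\Theta|$. Raw syntax. A signature $\Sigma$ assigns to each symbol $S$ an arity $(c,[(c_1,n_1),\dots,(c_k,n_k)])$ with $c\in\{\mathrm{Ty},\mathrm{Tm}\}$ (the class of $S$) and $c_i\in\{\mathrm{Ty},\mathrm{Tm},\mathrm{EqTy},\mathrm{EqTm}\}$: the $i$-th argument has class $c_i$ and binds $n_i$ variables. There are disjoint supplies of free variables $a,b,\dots$, bound variables $x,y,\dots$ and metavariables $M,N,\dots$. Type expressions are $S(e_1,\dots,e_k)$ ($S$ of class Ty) or $M(t_1,\dots,t_n)$ ($M$ of arity $(\mathrm{Ty},n)$); term expressions are $a$, $x$, $S(e_1,\dots,e_k)$ ($S$ of class Tm) or $M(t_1,\dots,t_n)$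 ($M$ of arity $(\mathrm{Tm},n)$); arguments are type or term expressions, a dummy $\star$ (of class EqTy or EqTm), or abstractions $\{x\}e$ binding $x$ in $e$; the $i$-th argument of $S$ must have the form $\{x_1\}\cdots\{x_{n_i}\}e'$ with $e'$ of class $c_i$. Expressions are identified up to renaming of bound variables; $e[\vec s/\vec x]$ is simultaneous capture-avoiding substitution, $e[a/x]$ replacement of a bound variable by a free one. Judgement theses: $A\ \mathsf{type}$, $t:A$, $A\equiv B$, $s\equiv t:A$; abstracted judgements $\mathcal J::=\text{thesis}\mid\{x{:}A\}\mathcal J$. Boundary theses: $\Box\ \mathsf{type}$, $\Box:A$, $A\equiv B\ \mathsf{by}\ \Box$, $s\equiv t:A\ \mathsf{by}\ \Box$; abstracted boundaries $\mathcal B::=\text{thesis}\mid\{x{:}A\}\mathcal B$. A metavariable context is a list $\Theta=[M_1{:}\mathcal B_1,\dots,M_n{:}\mathcal B_n]$ of distinct metavariables with closed boundaries, $\mathcal B_i$ mentioning only $M_1,\dots,M_{i-1}$; $M_i$ receives arity $\mathrm{ar}(\mathcal B_i)=(c,m)$ if $\mathcal B_i=\{x_1{:}A_1\}\cdots\{x_m{:}A_m\}\beta$ with $\beta$ of class $c$ (Ty, Tm, EqTy, EqTm for the four boundary forms). A variable context $\Gamma=[a_1{:}A_1,\dots,a_n{:}A_n]$ consists of distinct free variables with $A_i$ mentioning only $a_1,\dots,a_{i-1}$; $|\Gamma|$ is its domain and $\Gamma(a_i)=A_i$. Filling a boundary with a head: $(\Box\ \mathsf{type})[A]=(A\ \mathsf{type})$,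 $(\Box:A)[t]=(t:A)$, equality boundaries filled with $\star$ give the equation, $(\{x{:}A\}\mathcal B)[\{x\}e]=\{x{:}A\}(\mathcal B[e])$; filling a type/term boundary with an equation: $(\Box\ \mathsf{type})[A_1\equiv A_2]=(A_1\equiv A_2)$, $(\Box:A)[t_1\equiv t_2]=(t_1\equiv t_2:A)$, commuting with abstraction. Instantiation $I=\langle M_1\mapsto e_1,\dots,M_n\mapsto e_n\rangle$ of $\Xi$ (arguments of matching arities): $I_*(M_i(t_1,\dots,t_m))=e_i'[I_*t_1/x_1,\dots,I_*t_m/x_m]$ where $e_i=\{x_1\}\cdots\{x_m\}e_i'$, homomorphic elsewhere; $I_{(i)}$ is the restriction to $M_1,\dots,M_{i-1}$. Raw rules: $\Xi\Longrightarrow\mathcal J$ with $\mathcal J$ closed non-abstracted over $\Xi$; object rule if $\mathcal J$ is a type/term judgement. A raw type theory $T$ is a family of raw rules. Derivability $\vdash_T$ is membership in the least set closed under, for all $\Theta,\Gamma$: (variable rule) $\Theta;\Gamma\vdash a:\Gamma(a)$ for $a\in|\Gamma|$; (metavariable rule) if $\Theta(M)=\{x_1{:}A_1\}\cdots\{x_m{:}A_m\}\beta$, from $\Theta;\Gamma\vdash t_j:A_j[t_1,\dots,t_{j-1}/x_1,\dots,x_{j-1}]$ and $\Theta;\Gamma\vdash\beta[\vec t/\vec x]$ infer $\Theta;\Gamma\vdash(\beta[\vec t/\vec x])[M(\vec t)]$; (metavariable congruence) for object $\beta$, from $\Theta;\Gamma\vdash s_j:A_j[\vec s_{<j}/\vec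 x_{<j}]$, $\Theta;\Gamma\vdash t_j:A_j[\vec t_{<j}/\vec x_{<j}]$, $\Theta;\Gamma\vdash s_j\equiv t_j:A_j[\vec s_{<j}/\vec x_{<j}]$ and, if $\beta=(\Box:C)$, $\Theta;\Gamma\vdash C[\vec s/\vec x]\equiv C[\vec t/\vec x]$, infer $\Theta;\Gamma\vdash(\beta[\vec s/\vec x])[M(\vec s)\equiv M(\vec t)]$; (abstraction rule) from $\Theta;\Gamma\vdash A\ \mathsf{type}$ and $\Theta;\Gamma,a{:}A\vdash\mathcal J[a/x]$ with $a\notin|\Gamma|$ infer $\Theta;\Gamma\vdash\{x{:}A\}\mathcal J$; reflexivity, symmetry, transitivity of type and term equality; (term conversion) from $t:A$ and $A\equiv B$ infer $t:B$; (equality conversion) from $s\equiv t:A$ and $A\equiv B$ infer $s\equiv t:B$; boundary rules: $\Box\ \mathsf{type}$; $\Box:A$ from $A\ \mathsf{type}$; $A\equiv B\ \mathsf{by}\ \Box$ from $A\ \mathsf{type},B\ \mathsf{type}$; $s\equiv t:A\ \mathsf{by}\ \Box$ from $A\ \mathsf{type},s:A,t:A$; $\{x{:}A\}\mathcal B$ from $A\ \mathsf{type}$ and $\Theta;\Gamma,a{:}A\vdash\mathcal B[a/x]$, $a\notin|\Gamma|$; (instantiation of a specific rule) for a specific rule $[M_1{:}\mathcal B_1,\dots,M_n{:}\mathcal B_n]\Longrightarrow\beta[e]$ and $I=\langle M_i\mapsto e_i\rangle$ over $\Theta;\Gamma$: from $\Theta;\Gamma\vdash(I_{(i)*}\mathcal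 B_i)[e_i]$ for all $i$ and $\Theta;\Gamma\vdash I_*\beta$ infer $\Theta;\Gamma\vdash I_*(\beta[e])$; (congruence) for a specific object rule and $I=\langle M_i\mapsto f_i\rangle$, $J=\langle M_i\mapsto g_i\rangle$: from $\Theta;\Gamma\vdash(I_{(i)*}\mathcal B_i)[f_i]$, $\Theta;\Gamma\vdash(J_{(i)*}\mathcal B_i)[g_i]$ for all $i$, $\Theta;\Gamma\vdash(I_{(i)*}\mathcal B_i)[f_i\equiv g_i]$ for object $\mathcal B_i$, and $\Theta;\Gamma\vdash I_*B\equiv J_*B$ if $\beta=(\Box:B)$, infer $\Theta;\Gamma\vdash(I_*\beta)[I_*e\equiv J_*e]$. *)

theory Defs
  imports Main
begin

section \<open>Raw syntax\<close>

datatype cls = Ty | Tm | EqTy | EqTm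

type_synonym arity = "cls \<times> nat"

text \<open>The symbols of the signature are the elements of \<open>dom \<Sigma>\<close>.\<close>

type_synonym 's signature = "'s \<rightharpoonup> cls \<times> arity list"

definition signature :: "'s signature \<Rightarrow> bool" where
  "signature \<Sigma> \<longleftrightarrow> (\<forall>S c \<alpha>s. \<Sigma> S = Some (c, \<alpha>s) \<longrightarrow> c \<in> {Ty, Tm})"

type_synonym fvar = nat
type_synonym mvar = nat

text \<open>
  Expressions up to renaming of bound variables: free variables and metavariables are named,
  bound variables are de Bruijn indices. In the scope of \<open>{x\<^sub>1}\<dots>{x\<^sub>m}\<close> the variable \<open>x\<^sub>m\<close> has
  index \<open>0\<close> and \<open>x\<^sub>1\<close> has index \<open>m - 1\<close>. Classes and arities are imposed by \<open>raw_expr\<close> below.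
\<close>

datatype 's expr =
    FVar fvar
  | BVar nat
  | Sym 's "'s expr list"
  | Meta mvar "'s expr list"
  | Dummy
  | Abstr "'s expr"

text \<open>
  \<open>raw_expr \<Sigma> \<mu> V k (c, n) e\<close>: \<open>e\<close> has the form \<open>{x\<^sub>1}\<dots>{x\<^sub>n}e'\<close> with \<open>e'\<close> of class \<open>c\<close>, where
  the metavariables have the arities given by \<open>\<mu>\<close>, the free variables are among \<open>V\<close>, and
  the bound variables in scope are those with index below \<open>k\<close>.
\<close>

fun raw_expr ::
  "'s signature \<Rightarrow> (mvar \<rightharpoonup> arity) \<Rightarrow> fvar set \<Rightarrow> nat \<Rightarrow> arity \<Rightarrow> 's expr \<Rightarrow> bool" where
  "raw_expr \<Sigma> \<mu> V k (c, n) (FVar a) \<longleftrightarrow> n = 0 \<and> c = Tm \<and> a \<in> V"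
| "raw_expr \<Sigma> \<mu> V k (c, n) (BVar i) \<longleftrightarrow> n = 0 \<and> c = Tm \<and> i < k"
| "raw_expr \<Sigma> \<mu> V k (c, n) (Sym S es) \<longleftrightarrow>
     n = 0 \<and>
     (case \<Sigma> S of
        Some (c', \<alpha>s) \<Rightarrow> c = c' \<and> list_all2 (\<lambda>e \<alpha>. raw_expr \<Sigma> \<mu> V k \<alpha> e) es \<alpha>s
      | None \<Rightarrow> False)"
| "raw_expr \<Sigma> \<mu> V k (c, n) (Meta M ts) \<longleftrightarrow>
     n = 0 \<and> c \<in> {Ty, Tm} \<and> \<mu> M = Some (c, length ts) \<and>
     (\<forall>t \<in> set ts. raw_expr \<Sigma> \<mu> V k (Tm, 0) t)"
| "raw_expr \<Sigma> \<mu> V k (c, n) Dummy \<longleftrightarrow> n = 0 \<and> c \<in> {EqTy, EqTm}"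
| "raw_expr \<Sigma> \<mu> V k (c, n) (Abstr e) \<longleftrightarrow> 0 < n \<and> raw_expr \<Sigma> \<mu> V (Suc k) (c, n - 1) e"

fun lift :: "nat \<Rightarrow> nat \<Rightarrow> 's expr \<Rightarrow> 's expr" where
  "lift d k (FVar a) = FVar a"
| "lift d k (BVar i) = BVar (if i < k then i else i + d)"
| "lift d k (Sym S es) = Sym S (map (lift d k) es)"
| "lift d k (Meta M ts) = Meta M (map (lift d k) ts)"
| "lift d k Dummy = Dummy"
| "lift d k (Abstr e) = Abstr (lift d (Suc k) e)"

text \<open>
  \<open>subst k [t\<^sub>1, \<dots>, t\<^sub>m] e\<close> is \<open>e[t\<^sub>1/x\<^sub>1, \<dots>, t\<^sub>m/x\<^sub>m]\<close>, where \<open>x\<^sub>1, \<dots>, x\<^sub>m\<close> are the \<open>m\<close> innermost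
  bound variables outside the \<open>k\<close> binders already traversed; these \<open>m\<close> binders disappear.
\<close>

fun subst :: "nat \<Rightarrow> 's expr list \<Rightarrow> 's expr \<Rightarrow> 's expr" where
  "subst k ts (FVar a) = FVar a"
| "subst k ts (BVar i) =
     (if i < k then BVar i
      else if i < k + length ts then lift k 0 (rev ts ! (i - k))
      else BVar (i - length ts))"
| "subst k ts (Sym S es) = Sym S (map (subst k ts) es)"
| "subst k ts (Meta M us) = Meta M (map (subst k ts) us)"
| "subst k ts Dummy = Dummy"
| "subst k ts (Abstr e) = Abstr (subst (Suc k) ts e)"

fun strip_abstr :: "nat \<Rightarrow> 's expr \<Rightarrow> 's expr" where
  "strip_abstr 0 e = e"
| "strip_abstr (Suc n) (Abstr e) = strip_abstr n e"

text \<open>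
  The action \<open>I\<^sub>*\<close> of an instantiation. No lifting is needed under abstractions, since the
  arguments of an instantiation contain no loose bound variables.
\<close>

fun inst :: "(mvar \<rightharpoonup> 's expr) \<Rightarrow> 's expr \<Rightarrow> 's expr" where
  "inst I (FVar a) = FVar a"
| "inst I (BVar i) = BVar i"
| "inst I (Sym S es) = Sym S (map (inst I) es)"
| "inst I (Meta M ts) =
     (case I M of
        Some e \<Rightarrow> subst 0 (map (inst I) ts) (strip_abstr (length ts) e)
      | None \<Rightarrow> Meta M (map (inst I) ts))"
| "inst I Dummy = Dummy"
| "inst I (Abstr e) = Abstr (inst I e)"


section \<open>Judgements, boundaries and contexts\<close>

text \<open>The type parameter \<open>'e\<close> stands for expressions.\<close>

datatype 'e jthesis =
    IsType 'e
  | IsTerm 'e 'e       \<comment> \<open>\<open>IsTerm t A\<close> is \<open>t : A\<close>\<close>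
  | EqType 'e 'e
  | EqTerm 'e 'e 'e    \<comment> \<open>\<open>EqTerm s t A\<close> is \<open>s \<equiv> t : A\<close>\<close>

datatype 'e bthesis =
    BdType
  | BdTerm 'e
  | BdEqType 'e 'e
  | BdEqTerm 'e 'e 'e

datatype ('e, 't) abstracted =
    Thesis 't
  | Bind 'e "('e, 't) abstracted"

type_synonym 's judgement = "('s expr, 's expr jthesis) abstracted"
type_synonym 's boundary = "('s expr, 's expr bthesis) abstracted"

fun thesis_of :: "('e, 't) abstracted \<Rightarrow> 't" where
  "thesis_of (Thesis t) = t"
| "thesis_of (Bind A X) = thesis_of X"

fun object_jthesis :: "'e jthesis \<Rightarrow> bool" where
  "object_jthesis (IsType A) = True"
| "object_jthesis (IsTerm t A) = True"
| "object_jthesis (EqType A B) = False"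
| "object_jthesis (EqTerm s t A) = False"

fun object_bthesis :: "'e bthesis \<Rightarrow> bool" where
  "object_bthesis BdType = True"
| "object_bthesis (BdTerm A) = True"
| "object_bthesis (BdEqType A B) = False"
| "object_bthesis (BdEqTerm s t A) = False"

definition object_judgement :: "'s judgement \<Rightarrow> bool" where
  "object_judgement J \<longleftrightarrow> object_jthesis (thesis_of J)"

definition object_boundary :: "'s boundary \<Rightarrow> bool" where
  "object_boundary B \<longleftrightarrow> object_bthesis (thesis_of B)"

fun bcls :: "'e bthesis \<Rightarrow> cls" where
  "bcls BdType = Ty"
| "bcls (BdTerm A) = Tm"
| "bcls (BdEqType A B) = EqTy"
| "bcls (BdEqTerm s t A) = EqTm"

fun ar :: "'s boundary \<Rightarrow> arity" where
  "ar (Thesis \<beta>) = (bcls \<beta>, 0)"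
| "ar (Bind A B) = (fst (ar B), Suc (snd (ar B)))"

text \<open>
  \<open>map_scoped m f k\<close> applies \<open>f (k + d)\<close> to each expression below \<open>d\<close> binders; \<open>m\<close> is the map
  function of the thesis type.
\<close>

fun map_scoped ::
  "(('e \<Rightarrow> 'e) \<Rightarrow> 't \<Rightarrow> 't) \<Rightarrow> (nat \<Rightarrow> 'e \<Rightarrow> 'e) \<Rightarrow> nat \<Rightarrow> ('e, 't) abstracted \<Rightarrow> ('e, 't) abstracted"
where
  "map_scoped m f k (Thesis t) = Thesis (m (f k) t)"
| "map_scoped m f k (Bind A X) = Bind (f k A) (map_scoped m f (Suc k) X)"

definition subst_judgement :: "'s expr list \<Rightarrow> 's judgement \<Rightarrow> 's judgement" where
  "subst_judgement ts = map_scoped map_jthesis (\<lambda>k. subst k ts) 0"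

definition subst_boundary :: "'s expr list \<Rightarrow> 's boundary \<Rightarrow> 's boundary" where
  "subst_boundary ts = map_scoped map_bthesis (\<lambda>k. subst k ts) 0"

definition inst_boundary :: "(mvar \<rightharpoonup> 's expr) \<Rightarrow> 's boundary \<Rightarrow> 's boundary" where
  "inst_boundary I = map_scoped map_bthesis (\<lambda>_. inst I) 0"

text \<open>
  Filling. Equality boundaries determine the filled judgement, so the head (\<open>\<star>\<close>) is ignored
  there. The functions \<open>fill\<close> and \<open>fill_eq\<close> are only meaningful for heads of the arity of the
  boundary, and \<open>fill_eq\<close> only for object boundaries.
\<close>

fun fill_thesis :: "'e bthesis \<Rightarrow> 'e \<Rightarrow> 'e jthesis" where
  "fill_thesis BdType e = IsType e"
| "fill_thesis (BdTerm A) e = IsTerm e A"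
| "fill_thesis (BdEqType A B) e = EqType A B"
| "fill_thesis (BdEqTerm s t A) e = EqTerm s t A"

fun fill :: "'s boundary \<Rightarrow> 's expr \<Rightarrow> 's judgement" where
  "fill (Thesis \<beta>) e = Thesis (fill_thesis \<beta> e)"
| "fill (Bind A B) (Abstr e) = Bind A (fill B e)"

fun fill_eq_thesis :: "'e bthesis \<Rightarrow> 'e \<Rightarrow> 'e \<Rightarrow> 'e jthesis" where
  "fill_eq_thesis BdType e e' = EqType e e'"
| "fill_eq_thesis (BdTerm A) e e' = EqTerm e e' A"

fun fill_eq :: "'s boundary \<Rightarrow> 's expr \<Rightarrow> 's expr \<Rightarrow> 's judgement" where
  "fill_eq (Thesis \<beta>) e e' = Thesis (fill_eq_thesis \<beta> e e')"
| "fill_eq (Bind A B) (Abstr e) (Abstr e') = Bind A (fill_eq B e e')"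

type_synonym 's mctx = "(mvar \<times> 's boundary) list"
type_synonym 's vctx = "(fvar \<times> 's expr) list"

definition mctx_arities :: "'s mctx \<Rightarrow> (mvar \<rightharpoonup> arity)" where
  "mctx_arities \<Theta> = map_of (map (\<lambda>(M, B). (M, ar B)) \<Theta>)"

definition vdom :: "'s vctx \<Rightarrow> fvar set" where
  "vdom \<Gamma> = fst ` set \<Gamma>"

fun raw_jthesis ::
  "'s signature \<Rightarrow> (mvar \<rightharpoonup> arity) \<Rightarrow> fvar set \<Rightarrow> nat \<Rightarrow> 's expr jthesis \<Rightarrow> bool" where
  "raw_jthesis \<Sigma> \<mu> V k (IsType A) \<longleftrightarrow> raw_expr \<Sigma> \<mu> V k (Ty, 0) A"
| "raw_jthesis \<Sigma> \<mu> V k (IsTerm t A) \<longleftrightarrow>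
     raw_expr \<Sigma> \<mu> V k (Tm, 0) t \<and> raw_expr \<Sigma> \<mu> V k (Ty, 0) A"
| "raw_jthesis \<Sigma> \<mu> V k (EqType A B) \<longleftrightarrow>
     raw_expr \<Sigma> \<mu> V k (Ty, 0) A \<and> raw_expr \<Sigma> \<mu> V k (Ty, 0) B"
| "raw_jthesis \<Sigma> \<mu> V k (EqTerm s t A) \<longleftrightarrow>
     raw_expr \<Sigma> \<mu> V k (Tm, 0) s \<and> raw_expr \<Sigma> \<mu> V k (Tm, 0) t \<and> raw_expr \<Sigma> \<mu> V k (Ty, 0) A"

fun raw_bthesis ::
  "'s signature \<Rightarrow> (mvar \<rightharpoonup> arity) \<Rightarrow> fvar set \<Rightarrow> nat \<Rightarrow> 's expr bthesis \<Rightarrow> bool" where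
  "raw_bthesis \<Sigma> \<mu> V k BdType \<longleftrightarrow> True"
| "raw_bthesis \<Sigma> \<mu> V k (BdTerm A) \<longleftrightarrow> raw_expr \<Sigma> \<mu> V k (Ty, 0) A"
| "raw_bthesis \<Sigma> \<mu> V k (BdEqType A B) \<longleftrightarrow>
     raw_expr \<Sigma> \<mu> V k (Ty, 0) A \<and> raw_expr \<Sigma> \<mu> V k (Ty, 0) B"
| "raw_bthesis \<Sigma> \<mu> V k (BdEqTerm s t A) \<longleftrightarrow>
     raw_expr \<Sigma> \<mu> V k (Tm, 0) s \<and> raw_expr \<Sigma> \<mu> V k (Tm, 0) t \<and> raw_expr \<Sigma> \<mu> V k (Ty, 0) A"

fun raw_judgement ::
  "'s signature \<Rightarrow> (mvar \<rightharpoonup> arity) \<Rightarrow> fvar set \<Rightarrow> nat \<Rightarrow> 's judgement \<Rightarrow> bool" where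
  "raw_judgement \<Sigma> \<mu> V k (Thesis j) \<longleftrightarrow> raw_jthesis \<Sigma> \<mu> V k j"
| "raw_judgement \<Sigma> \<mu> V k (Bind A J) \<longleftrightarrow>
     raw_expr \<Sigma> \<mu> V k (Ty, 0) A \<and> raw_judgement \<Sigma> \<mu> V (Suc k) J"

fun raw_boundary ::
  "'s signature \<Rightarrow> (mvar \<rightharpoonup> arity) \<Rightarrow> fvar set \<Rightarrow> nat \<Rightarrow> 's boundary \<Rightarrow> bool" where
  "raw_boundary \<Sigma> \<mu> V k (Thesis \<beta>) \<longleftrightarrow> raw_bthesis \<Sigma> \<mu> V k \<beta>"
| "raw_boundary \<Sigma> \<mu> V k (Bind A B) \<longleftrightarrow>
     raw_expr \<Sigma> \<mu> V k (Ty, 0) A \<and> raw_boundary \<Sigma> \<mu> V (Suc k) B"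

definition raw_mctx :: "'s signature \<Rightarrow> 's mctx \<Rightarrow> bool" where
  "raw_mctx \<Sigma> \<Theta> \<longleftrightarrow>
     distinct (map fst \<Theta>) \<and>
     (\<forall>i < length \<Theta>. raw_boundary \<Sigma> (mctx_arities (take i \<Theta>)) {} 0 (snd (\<Theta> ! i)))"

definition raw_vctx :: "'s signature \<Rightarrow> 's mctx \<Rightarrow> 's vctx \<Rightarrow> bool" where
  "raw_vctx \<Sigma> \<Theta> \<Gamma> \<longleftrightarrow>
     distinct (map fst \<Gamma>) \<and>
     (\<forall>i < length \<Gamma>. raw_expr \<Sigma> (mctx_arities \<Theta>) (vdom (take i \<Gamma>)) 0 (Ty, 0) (snd (\<Gamma> ! i)))"

text \<open>\<open>(\<Theta>, \<Gamma>, Jdg J)\<close> is \<open>\<Theta>; \<Gamma> \<turnstile> J\<close> and \<open>(\<Theta>, \<Gamma>, Bdry B)\<close> is \<open>\<Theta>; \<Gamma> \<turnstile> B\<close>.\<close>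

datatype 's statement = Jdg "'s judgement" | Bdry "'s boundary"

type_synonym 's sequent = "'s mctx \<times> 's vctx \<times> 's statement"

fun raw_sequent :: "'s signature \<Rightarrow> 's sequent \<Rightarrow> bool" where
  "raw_sequent \<Sigma> (\<Theta>, \<Gamma>, Jdg J) \<longleftrightarrow>
     raw_mctx \<Sigma> \<Theta> \<and> raw_vctx \<Sigma> \<Theta> \<Gamma> \<and> raw_judgement \<Sigma> (mctx_arities \<Theta>) (vdom \<Gamma>) 0 J"
| "raw_sequent \<Sigma> (\<Theta>, \<Gamma>, Bdry B) \<longleftrightarrow>
     raw_mctx \<Sigma> \<Theta> \<and> raw_vctx \<Sigma> \<Theta> \<Gamma> \<and> raw_boundary \<Sigma> (mctx_arities \<Theta>) (vdom \<Gamma>) 0 B"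

abbreviation "type_seq \<Theta> \<Gamma> A \<equiv> (\<Theta>, \<Gamma>, Jdg (Thesis (IsType A)))"
abbreviation "term_seq \<Theta> \<Gamma> t A \<equiv> (\<Theta>, \<Gamma>, Jdg (Thesis (IsTerm t A)))"
abbreviation "eqtype_seq \<Theta> \<Gamma> A B \<equiv> (\<Theta>, \<Gamma>, Jdg (Thesis (EqType A B)))"
abbreviation "eqterm_seq \<Theta> \<Gamma> s t A \<equiv> (\<Theta>, \<Gamma>, Jdg (Thesis (EqTerm s t A)))"


section \<open>Raw theories and derivability\<close>

type_synonym 's raw_rule = "'s mctx \<times> 's expr jthesis"

definition raw_rule :: "'s signature \<Rightarrow> 's raw_rule \<Rightarrow> bool" where
  "raw_rule \<Sigma> R \<longleftrightarrow>
     raw_mctx \<Sigma> (fst R) \<and> raw_jthesis \<Sigma> (mctx_arities (fst R)) {} 0 (snd R)"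

text \<open>A family of rules indexed by \<open>dom T\<close>.\<close>

type_synonym ('i, 's) raw_theory = "'i \<rightharpoonup> 's raw_rule"

definition raw_theory :: "'s signature \<Rightarrow> ('i, 's) raw_theory \<Rightarrow> bool" where
  "raw_theory \<Sigma> T \<longleftrightarrow> signature \<Sigma> \<and> (\<forall>R \<in> ran T. raw_rule \<Sigma> R)"

definition instantiation_of :: "'s mctx \<Rightarrow> 's expr list \<Rightarrow> (mvar \<rightharpoonup> 's expr)" where
  "instantiation_of \<Xi> es = map_of (zip (map fst \<Xi>) es)"

definition raw_instantiation ::
  "'s signature \<Rightarrow> 's mctx \<Rightarrow> 's vctx \<Rightarrow> 's mctx \<Rightarrow> 's expr list \<Rightarrow> bool" where
  "raw_instantiation \<Sigma> \<Theta> \<Gamma> \<Xi> es \<longleftrightarrow>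
     list_all2 (\<lambda>e (M, B). raw_expr \<Sigma> (mctx_arities \<Theta>) (vdom \<Gamma>) 0 (ar B) e) es \<Xi>"

text \<open>The boundary \<open>I\<^sub>(\<^sub>i\<^sub>)\<^sub>* \<B>\<^sub>i\<close>, with indices starting at \<open>0\<close>.\<close>

definition inst_premise :: "'s mctx \<Rightarrow> 's expr list \<Rightarrow> nat \<Rightarrow> 's boundary" where
  "inst_premise \<Xi> es i = inst_boundary (instantiation_of (take i \<Xi>) (take i es)) (snd (\<Xi> ! i))"

datatype 's closure_rule =
    Variable | Metavariable | Metavariable_Cong | Abstraction
  | Type_Refl | Type_Sym | Type_Trans
  | Term_Refl | Term_Sym | Term_Trans
  | Term_Conversion | Eq_Conversion
  | Bdry_Type | Bdry_Term | Bdry_EqType | Bdry_EqTerm | Bdry_Abstraction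
  | Instantiation "'s raw_rule" | Congruence "'s raw_rule"

text \<open>\<open>closure_inst \<Sigma> T r ps c\<close>: the rule \<open>r\<close> infers \<open>c\<close> from the premises \<open>ps\<close>.\<close>

inductive closure_inst ::
  "'s signature \<Rightarrow> ('i, 's) raw_theory \<Rightarrow> 's closure_rule \<Rightarrow> 's sequent list \<Rightarrow> 's sequent \<Rightarrow> bool"
  for \<Sigma> :: "'s signature" and T :: "('i, 's) raw_theory"
where
  variable:
  "map_of \<Gamma> a = Some A \<Longrightarrow>
   closure_inst \<Sigma> T Variable [] (term_seq \<Theta> \<Gamma> (FVar a) A)"
| metavariable:
  "map_of \<Theta> M = Some (foldr Bind As (Thesis \<beta>)) \<Longrightarrow> length ts = length As \<Longrightarrow>
   closure_inst \<Sigma> T Metavariable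
     (map (\<lambda>j. term_seq \<Theta> \<Gamma> (ts ! j) (subst 0 (take j ts) (As ! j))) [0..<length As]
      @ [(\<Theta>, \<Gamma>, Bdry (subst_boundary ts (Thesis \<beta>)))])
     (\<Theta>, \<Gamma>, Jdg (fill (subst_boundary ts (Thesis \<beta>)) (Meta M ts)))"
| metavariable_cong:
  "map_of \<Theta> M = Some (foldr Bind As (Thesis \<beta>)) \<Longrightarrow> object_bthesis \<beta> \<Longrightarrow>
   length ss = length As \<Longrightarrow> length ts = length As \<Longrightarrow>
   closure_inst \<Sigma> T Metavariable_Cong
     (map (\<lambda>j. term_seq \<Theta> \<Gamma> (ss ! j) (subst 0 (take j ss) (As ! j))) [0..<length As]
      @ map (\<lambda>j. term_seq \<Theta> \<Gamma> (ts ! j) (subst 0 (take j ts) (As ! j))) [0..<length As]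
      @ map (\<lambda>j. eqterm_seq \<Theta> \<Gamma> (ss ! j) (ts ! j) (subst 0 (take j ss) (As ! j))) [0..<length As]
      @ (case \<beta> of BdTerm C \<Rightarrow> [eqtype_seq \<Theta> \<Gamma> (subst 0 ss C) (subst 0 ts C)] | _ \<Rightarrow> []))
     (\<Theta>, \<Gamma>, Jdg (fill_eq (subst_boundary ss (Thesis \<beta>)) (Meta M ss) (Meta M ts)))"
| abstraction:
  "a \<notin> vdom \<Gamma> \<Longrightarrow>
   closure_inst \<Sigma> T Abstraction
     [type_seq \<Theta> \<Gamma> A, (\<Theta>, \<Gamma> @ [(a, A)], Jdg (subst_judgement [FVar a] J))]
     (\<Theta>, \<Gamma>, Jdg (Bind A J))"
| type_refl:
  "closure_inst \<Sigma> T Type_Refl [type_seq \<Theta> \<Gamma> A] (eqtype_seq \<Theta> \<Gamma> A A)"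
| type_sym:
  "closure_inst \<Sigma> T Type_Sym [eqtype_seq \<Theta> \<Gamma> A B] (eqtype_seq \<Theta> \<Gamma> B A)"
| type_trans:
  "closure_inst \<Sigma> T Type_Trans
     [eqtype_seq \<Theta> \<Gamma> A B, eqtype_seq \<Theta> \<Gamma> B C] (eqtype_seq \<Theta> \<Gamma> A C)"
| term_refl:
  "closure_inst \<Sigma> T Term_Refl [term_seq \<Theta> \<Gamma> t A] (eqterm_seq \<Theta> \<Gamma> t t A)"
| term_sym:
  "closure_inst \<Sigma> T Term_Sym [eqterm_seq \<Theta> \<Gamma> s t A] (eqterm_seq \<Theta> \<Gamma> t s A)"
| term_trans:
  "closure_inst \<Sigma> T Term_Trans
     [eqterm_seq \<Theta> \<Gamma> s t A, eqterm_seq \<Theta> \<Gamma> t u A] (eqterm_seq \<Theta> \<Gamma> s u A)"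
| term_conversion:
  "closure_inst \<Sigma> T Term_Conversion
     [term_seq \<Theta> \<Gamma> t A, eqtype_seq \<Theta> \<Gamma> A B] (term_seq \<Theta> \<Gamma> t B)"
| eq_conversion:
  "closure_inst \<Sigma> T Eq_Conversion
     [eqterm_seq \<Theta> \<Gamma> s t A, eqtype_seq \<Theta> \<Gamma> A B] (eqterm_seq \<Theta> \<Gamma> s t B)"
| bdry_type:
  "closure_inst \<Sigma> T Bdry_Type [] (\<Theta>, \<Gamma>, Bdry (Thesis BdType))"
| bdry_term:
  "closure_inst \<Sigma> T Bdry_Term [type_seq \<Theta> \<Gamma> A] (\<Theta>, \<Gamma>, Bdry (Thesis (BdTerm A)))"
| bdry_eqtype:
  "closure_inst \<Sigma> T Bdry_EqType
     [type_seq \<Theta> \<Gamma> A, type_seq \<Theta> \<Gamma> B] (\<Theta>, \<Gamma>, Bdry (Thesis (BdEqType A B)))"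
| bdry_eqterm:
  "closure_inst \<Sigma> T Bdry_EqTerm
     [type_seq \<Theta> \<Gamma> A, term_seq \<Theta> \<Gamma> s A, term_seq \<Theta> \<Gamma> t A]
     (\<Theta>, \<Gamma>, Bdry (Thesis (BdEqTerm s t A)))"
| bdry_abstraction:
  "a \<notin> vdom \<Gamma> \<Longrightarrow>
   closure_inst \<Sigma> T Bdry_Abstraction
     [type_seq \<Theta> \<Gamma> A, (\<Theta>, \<Gamma> @ [(a, A)], Bdry (subst_boundary [FVar a] B))]
     (\<Theta>, \<Gamma>, Bdry (Bind A B))"
| instantiate:
  "(\<Xi>, fill_thesis \<beta> e) \<in> ran T \<Longrightarrow> raw_instantiation \<Sigma> \<Theta> \<Gamma> \<Xi> es \<Longrightarrow>
   I = instantiation_of \<Xi> es \<Longrightarrow>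
   closure_inst \<Sigma> T (Instantiation (\<Xi>, fill_thesis \<beta> e))
     (map (\<lambda>i. (\<Theta>, \<Gamma>, Jdg (fill (inst_premise \<Xi> es i) (es ! i)))) [0..<length \<Xi>]
      @ [(\<Theta>, \<Gamma>, Bdry (inst_boundary I (Thesis \<beta>)))])
     (\<Theta>, \<Gamma>, Jdg (Thesis (map_jthesis (inst I) (fill_thesis \<beta> e))))"
| congruence:
  "(\<Xi>, fill_thesis \<beta> e) \<in> ran T \<Longrightarrow> object_bthesis \<beta> \<Longrightarrow>
   raw_instantiation \<Sigma> \<Theta> \<Gamma> \<Xi> fs \<Longrightarrow> raw_instantiation \<Sigma> \<Theta> \<Gamma> \<Xi> gs \<Longrightarrow>
   I = instantiation_of \<Xi> fs \<Longrightarrow> J = instantiation_of \<Xi> gs \<Longrightarrow>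
   closure_inst \<Sigma> T (Congruence (\<Xi>, fill_thesis \<beta> e))
     (map (\<lambda>i. (\<Theta>, \<Gamma>, Jdg (fill (inst_premise \<Xi> fs i) (fs ! i)))) [0..<length \<Xi>]
      @ map (\<lambda>i. (\<Theta>, \<Gamma>, Jdg (fill (inst_premise \<Xi> gs i) (gs ! i)))) [0..<length \<Xi>]
      @ map (\<lambda>i. (\<Theta>, \<Gamma>, Jdg (fill_eq (inst_premise \<Xi> fs i) (fs ! i) (gs ! i))))
          (filter (\<lambda>i. object_boundary (snd (\<Xi> ! i))) [0..<length \<Xi>])
      @ (case \<beta> of BdTerm B \<Rightarrow> [eqtype_seq \<Theta> \<Gamma> (inst I B) (inst J B)] | _ \<Rightarrow> []))
     (\<Theta>, \<Gamma>, Jdg (fill_eq (inst_boundary I (Thesis \<beta>)) (inst I e) (inst J e)))"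

text \<open>
  Derivability, restricted to syntactically well-formed sequents. In particular the body of an
  abstraction cannot mention the fresh free variable of the abstraction rule.
\<close>

inductive derivable :: "'s signature \<Rightarrow> ('i, 's) raw_theory \<Rightarrow> 's sequent \<Rightarrow> bool"
  for \<Sigma> :: "'s signature" and T :: "('i, 's) raw_theory"
where
  "closure_inst \<Sigma> T r ps c \<Longrightarrow> raw_sequent \<Sigma> c \<Longrightarrow> (\<And>p. p \<in> set ps \<Longrightarrow> derivable \<Sigma> T p) \<Longrightarrow>
   derivable \<Sigma> T c"

datatype 's deriv_tree =
  Infer (last_rule: "'s closure_rule") (conclusion: "'s sequent") (subderivations: "'s deriv_tree list")

inductive derivation :: "'s signature \<Rightarrow> ('i, 's) raw_theory \<Rightarrow> 's deriv_tree \<Rightarrow> bool"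
  for \<Sigma> :: "'s signature" and T :: "('i, 's) raw_theory"
where
  "closure_inst \<Sigma> T r (map conclusion Ds) c \<Longrightarrow> raw_sequent \<Sigma> c \<Longrightarrow>
   (\<And>D. D \<in> set Ds \<Longrightarrow> derivation \<Sigma> T D) \<Longrightarrow> derivation \<Sigma> T (Infer r c Ds)"

lemma derivable_iff_derivation:
  "derivable \<Sigma> T c \<longleftrightarrow> (\<exists>D. derivation \<Sigma> T D \<and> conclusion D = c)"
proof
  assume "derivable \<Sigma> T c"
  then show "\<exists>D. derivation \<Sigma> T D \<and> conclusion D = c"
  proof (induction rule: derivable.induct)
    case (1 r ps c)
    then obtain f where f: "\<And>p. p \<in> set ps \<Longrightarrow> derivation \<Sigma> T (f p) \<and> conclusion (f p) = p"
      by metis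
    then have "map conclusion (map f ps) = ps"
      by (simp add: map_idI)
    with 1 f have "derivation \<Sigma> T (Infer r c (map f ps))"
      by (intro derivation.intros) auto
    then show ?case
      by (metis deriv_tree.sel(2))
  qed
next
  assume "\<exists>D. derivation \<Sigma> T D \<and> conclusion D = c"
  then obtain D where "derivation \<Sigma> T D" "conclusion D = c"
    by blast
  then show "derivable \<Sigma> T c"
  proof (induction arbitrary: c rule: derivation.induct)
    case (1 r Ds c')
    have "derivable \<Sigma> T p" if "p \<in> set (map conclusion Ds)" for p
      using that 1(4) by (metis imageE list.set_map)
    with 1 show ?case
      using derivable.intros[of \<Sigma> T r "map conclusion Ds" c] by auto
  qed
qed


section \<open>Standard theories\<close>

inductive mctx_derivable :: "'s signature \<Rightarrow> ('i, 's) raw_theory \<Rightarrow> 's mctx \<Rightarrow> bool"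
  for \<Sigma> :: "'s signature" and T :: "('i, 's) raw_theory"
where
  "mctx_derivable \<Sigma> T []"
| "mctx_derivable \<Sigma> T \<Theta> \<Longrightarrow> derivable \<Sigma> T (\<Theta>, [], Bdry B) \<Longrightarrow> M \<notin> fst ` set \<Theta> \<Longrightarrow>
   mctx_derivable \<Sigma> T (\<Theta> @ [(M, B)])"

definition finitary_rule :: "'s signature \<Rightarrow> ('i, 's) raw_theory \<Rightarrow> 's raw_rule \<Rightarrow> bool" where
  "finitary_rule \<Sigma> T R \<longleftrightarrow>
     (\<exists>\<Xi> \<beta> e. R = (\<Xi>, fill_thesis \<beta> e) \<and>
        mctx_derivable \<Sigma> T \<Xi> \<and> derivable \<Sigma> T (\<Xi>, [], Bdry (Thesis \<beta>)))"

definition finitary_theory :: "'s signature \<Rightarrow> ('i, 's) raw_theory \<Rightarrow> bool" where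
  "finitary_theory \<Sigma> T \<longleftrightarrow>
     raw_theory \<Sigma> T \<and>
     (\<exists>r. r \<subseteq> dom T \<times> dom T \<and> trans r \<and> wf r \<and>
        (\<forall>i R. T i = Some R \<longrightarrow> finitary_rule \<Sigma> (T |` {j. (j, i) \<in> r}) R))"

fun generic_arg :: "mvar \<times> 's boundary \<Rightarrow> 's expr" where
  "generic_arg (M, B) =
     (let (c, k) = ar B in
      (Abstr ^^ k) (if c \<in> {Ty, Tm} then Meta M (map BVar (rev [0..<k])) else Dummy))"

definition symbol_rule :: "'s signature \<Rightarrow> 's \<Rightarrow> 's raw_rule \<Rightarrow> bool" where
  "symbol_rule \<Sigma> S R \<longleftrightarrow>
     (\<exists>\<Xi> \<beta>. raw_mctx \<Sigma> \<Xi> \<and> raw_bthesis \<Sigma> (mctx_arities \<Xi>) {} 0 \<beta> \<and> object_bthesis \<beta> \<and>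
        \<Sigma> S = Some (bcls \<beta>, map (\<lambda>(M, B). ar B) \<Xi>) \<and>
        R = (\<Xi>, fill_thesis \<beta> (Sym S (map generic_arg \<Xi>))))"

definition standard_theory :: "'s signature \<Rightarrow> ('i, 's) raw_theory \<Rightarrow> bool" where
  "standard_theory \<Sigma> T \<longleftrightarrow>
     finitary_theory \<Sigma> T \<and>
     (\<forall>R \<in> ran T. object_jthesis (snd R) \<longrightarrow> (\<exists>S. symbol_rule \<Sigma> S R)) \<and>
     (\<forall>S \<in> dom \<Sigma>. \<exists>!i. \<exists>R. T i = Some R \<and> symbol_rule \<Sigma> S R)"

text \<open>Only meaningful for terms that are syntactically well-formed over the contexts.\<close>

fun natural_type ::
  "'s signature \<Rightarrow> ('i, 's) raw_theory \<Rightarrow> 's mctx \<Rightarrow> 's vctx \<Rightarrow> 's expr \<Rightarrow> 's expr" where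
  "natural_type \<Sigma> T \<Theta> \<Gamma> (FVar a) = the (map_of \<Gamma> a)"
| "natural_type \<Sigma> T \<Theta> \<Gamma> (Meta M ts) =
     (case thesis_of (the (map_of \<Theta> M)) of BdTerm B \<Rightarrow> subst 0 ts B)"
| "natural_type \<Sigma> T \<Theta> \<Gamma> (Sym S es) =
     (case (THE R. R \<in> ran T \<and> symbol_rule \<Sigma> S R) of
        (\<Xi>, IsTerm t B) \<Rightarrow> inst (instantiation_of \<Xi> es) B)"

datatype final_step =
  By_Variable | By_Metavariable | By_Symbol_Rule | By_Abstraction | By_Natural_Conversion

fun concludes_with ::
  "'s signature \<Rightarrow> ('i, 's) raw_theory \<Rightarrow> 's deriv_tree \<Rightarrow> final_step \<Rightarrow> bool" where
  "concludes_with \<Sigma> T D By_Variable \<longleftrightarrow> last_rule D = Variable"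
| "concludes_with \<Sigma> T D By_Metavariable \<longleftrightarrow> last_rule D = Metavariable"
| "concludes_with \<Sigma> T D By_Symbol_Rule \<longleftrightarrow>
     (\<exists>R S. R \<in> ran T \<and> symbol_rule \<Sigma> S R \<and> last_rule D = Instantiation R)"
| "concludes_with \<Sigma> T D By_Abstraction \<longleftrightarrow> last_rule D = Abstraction"
| "concludes_with \<Sigma> T D By_Natural_Conversion \<longleftrightarrow>
     last_rule D = Term_Conversion \<and>
     (\<exists>\<Theta> \<Gamma> t A. conclusion D = term_seq \<Theta> \<Gamma> t A \<and>
        map conclusion (subderivations D) =
          [term_seq \<Theta> \<Gamma> t (natural_type \<Sigma> T \<Theta> \<Gamma> t),
           eqtype_seq \<Theta> \<Gamma> (natural_type \<Sigma> T \<Theta> \<Gamma> t) A] \<and>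
        natural_type \<Sigma> T \<Theta> \<Gamma> t \<noteq> A)"

end

theory Submission
  imports Defs
begin

text \<open>
  Every object rule other than abstraction and conversion determines its conclusion from the
  head of the subject: a term introduced by a variable, a metavariable or a symbol rule is
  given precisely its natural type. For symbol rules this needs that instantiating the generic
  arguments recovers the arguments of the instantiation. Consecutive conversions are merged by
  transitivity of type equality, and they disappear altogether when the resulting type is
  already the natural one. The final step can thus be read off the judgement.
\<close>

section \<open>Recovering the arguments of an instantiation from generic arguments\<close>

text \<open>\<open>subst\<close> indexes the reversed list, so index \<open>k + i\<close> with
  \<open>i < n\<close> is sent to \<open>lift k 0 (BVar i)\<close>, which is
  \<open>BVar (k + i)\<close> again. The bound \<open>k + n\<close> on loose variables rules out the
  clause that lowers indices.\<close>

lemma subst_bvars_id: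
  "raw_expr \<Sigma> \<mu> V (k + n) \<alpha> e \<Longrightarrow> subst k (map BVar (rev [0..<n])) e = e"
proof (induction e arbitrary: k \<alpha>)
  case (Sym S es)
  obtain c m where \<alpha>: "\<alpha> = (c, m)"
    by (cases \<alpha>)
  have "subst k (map BVar (rev [0..<n])) e = e" if e: "e \<in> set es" for e
  proof -
    from Sym.prems \<alpha> obtain \<alpha>s where
      "list_all2 (\<lambda>e \<alpha>. raw_expr \<Sigma> \<mu> V (k + n) \<alpha> e) es \<alpha>s"
      by (auto split: option.splits)
    with e obtain \<alpha>' where "raw_expr \<Sigma> \<mu> V (k + n) \<alpha>' e"
      by (metis in_set_conv_nth list_all2_nthD)
    with Sym.IH e show ?thesis
      by blast
  qed
  then show ?case
    by (simp add: map_idI)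
next
  case (Meta M ts)
  obtain c m where "\<alpha> = (c, m)"
    by (cases \<alpha>)
  with Meta show ?case
    by (auto intro!: map_idI)
next
  case (Abstr e)
  obtain c m where "\<alpha> = (c, m)"
    by (cases \<alpha>)
  with Abstr show ?case
    by (metis add_Suc raw_expr.simps(6) subst.simps(6))
qed (auto simp: rev_map)

lemma raw_expr_abstr:
  assumes "raw_expr \<Sigma> \<mu> V k (c, n) e"
  obtains e' where "e = (Abstr ^^ n) e'" "raw_expr \<Sigma> \<mu> V (k + n) (c, 0) e'"
  using assms
proof (induction n arbitrary: k e thesis)
  case 0
  then show ?case by simp
next
  case (Suc n)
  from Suc.prems(2) obtain e1 where e1: "e = Abstr e1" "raw_expr \<Sigma> \<mu> V (Suc k) (c, n) e1"
    by (cases e) auto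
  from Suc.IH[OF _ e1(2)] obtain e' where
    "e1 = (Abstr ^^ n) e'" "raw_expr \<Sigma> \<mu> V (Suc k + n) (c, 0) e'" .
  with e1 Suc.prems(1) show ?case
    by auto
qed

lemma strip_abstr_abstr [simp]: "strip_abstr n ((Abstr ^^ n) e) = e"
  by (induction n) auto

lemma inst_abstr [simp]: "inst I ((Abstr ^^ n) e) = (Abstr ^^ n) (inst I e)"
  by (induction n) auto

text \<open>\<open>signature\<close> admits no symbol of an equation class, which leaves only
  \<open>Dummy\<close> at depth \<open>0\<close>.\<close>

lemma raw_expr_equation_Dummy:
  assumes "signature \<Sigma>" "raw_expr \<Sigma> \<mu> V k (c, 0) e" "c \<notin> {Ty, Tm}"
  shows "e = Dummy"
  using assms by (cases e) (auto simp: signature_def split: option.splits)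

text \<open>For an object class, the generic argument is the eta-expansion of \<open>M\<close>:
  instantiating it strips the \<open>n\<close> abstractions of \<open>e\<close> and substitutes the
  bound variables for themselves. For an equation class, both sides are an abstracted
  \<open>Dummy\<close>.\<close>

lemma inst_generic_arg:
  assumes "signature \<Sigma>" "I M = Some e" "raw_expr \<Sigma> \<mu> V 0 (ar B) e"
  shows "inst I (generic_arg (M, B)) = e"
proof -
  obtain c n where ar: "ar B = (c, n)"
    by (cases "ar B")
  with assms(3) obtain e' where e': "e = (Abstr ^^ n) e'" "raw_expr \<Sigma> \<mu> V (0 + n) (c, 0) e'"
    by (metis raw_expr_abstr)
  have "map (inst I) (map BVar (rev [0..<n])) = map BVar (rev [0..<n])"
    by simp
  then have "inst I (Meta M (map BVar (rev [0..<n]))) = e'"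
    using assms(2) e' subst_bvars_id[OF e'(2)] by (simp del: map_map)
  moreover have "e' = Dummy" if "c \<notin> {Ty, Tm}"
    using raw_expr_equation_Dummy[OF assms(1) e'(2) that] .
  ultimately show ?thesis
    using ar e'(1) by simp
qed

lemma inst_generic_args:
  assumes "signature \<Sigma>" "raw_mctx \<Sigma> \<Xi>" "raw_instantiation \<Sigma> \<Theta> \<Gamma> \<Xi> es"
  shows "map (inst (instantiation_of \<Xi> es)) (map generic_arg \<Xi>) = es"
proof (rule nth_equalityI)
  have len: "length es = length \<Xi>"
    using assms(3) by (simp add: raw_instantiation_def list_all2_lengthD)
  then show "length (map (inst (instantiation_of \<Xi> es)) (map generic_arg \<Xi>)) = length es"
    by simp
  fix i
  assume "i < length (map (inst (instantiation_of \<Xi> es)) (map generic_arg \<Xi>))"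
  then have i: "i < length \<Xi>"
    by simp
  obtain M B where MB: "\<Xi> ! i = (M, B)"
    by (cases "\<Xi> ! i")
  have "raw_expr \<Sigma> (mctx_arities \<Theta>) (vdom \<Gamma>) 0 (ar B) (es ! i)"
    using assms(3) i len MB list_all2_nthD2 by (fastforce simp: raw_instantiation_def)
  \<comment> \<open>The metavariables of a \<open>raw_mctx\<close> are distinct, so the lookup finds
    position \<open>i\<close>.\<close>
  moreover have "instantiation_of \<Xi> es M = Some (es ! i)"
    using assms(2) i len MB map_of_zip_nth[of "map fst \<Xi>" es i]
    by (simp add: instantiation_of_def raw_mctx_def)
  ultimately show "map (inst (instantiation_of \<Xi> es)) (map generic_arg \<Xi>) ! i = es ! i"
    using inst_generic_arg[OF assms(1)] i MB by simp
qed

section \<open>Symbol rules and natural types\<close>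

lemma derivable_raw_sequent: "derivable \<Sigma> T c \<Longrightarrow> raw_sequent \<Sigma> c"
  by (erule derivable.cases) simp

lemma standard_theory_signature: "standard_theory \<Sigma> T \<Longrightarrow> signature \<Sigma>"
  by (simp add: standard_theory_def finitary_theory_def raw_theory_def)

text \<open>\<open>standard_theory\<close> provides a unique index, whereas
  \<open>natural_type\<close> selects a rule; the two agree because \<open>T\<close> maps each index
  to one rule.\<close>

lemma the_symbol_rule:
  assumes "standard_theory \<Sigma> T" "R \<in> ran T" "symbol_rule \<Sigma> S R"
  shows "(THE R. R \<in> ran T \<and> symbol_rule \<Sigma> S R) = R"
proof (rule the_equality)
  have "S \<in> dom \<Sigma>"
    using assms(3) by (auto simp: symbol_rule_def)
  then have "\<exists>!i. \<exists>R. T i = Some R \<and> symbol_rule \<Sigma> S R"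
    using assms(1) by (simp add: standard_theory_def)
  then show "R' = R" if "R' \<in> ran T \<and> symbol_rule \<Sigma> S R'" for R'
    using that assms(2,3) unfolding ran_def mem_Collect_eq by (metis option.inject)
qed (use assms in simp)

fun subject :: "'e jthesis \<Rightarrow> 'e" where
  "subject (IsType A) = A"
| "subject (IsTerm t A) = t"
| "subject (EqType A B) = A"
| "subject (EqTerm s t A) = s"

text \<open>The values at \<open>BVar\<close>, \<open>Dummy\<close> and \<open>Abstr\<close> are junk: these are never subjects of derivable theses.\<close>

fun head_step :: "'s expr \<Rightarrow> final_step" where
  "head_step (FVar a) = By_Variable"
| "head_step (Meta M ts) = By_Metavariable"
| "head_step e = By_Symbol_Rule"

text \<open>\<open>Term_Conversion\<close> concludes only term judgements, so every other thesis
  counts as natural.\<close>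

fun natural_thesis ::
  "'s signature \<Rightarrow> ('i, 's) raw_theory \<Rightarrow> 's mctx \<Rightarrow> 's vctx \<Rightarrow> 's expr jthesis \<Rightarrow> bool" where
  "natural_thesis \<Sigma> T \<Theta> \<Gamma> (IsTerm t A) \<longleftrightarrow> natural_type \<Sigma> T \<Theta> \<Gamma> t = A"
| "natural_thesis \<Sigma> T \<Theta> \<Gamma> _ \<longleftrightarrow> True"

text \<open>Once the generic arguments are recovered, a term rule assigns the type
  \<open>inst (instantiation_of \<Xi> es) B\<close>, exactly what the \<open>Sym\<close> clause of
  \<open>natural_type\<close> computes.\<close>

lemma instantiate_symbol_rule:
  assumes std: "standard_theory \<Sigma> T"
    and R: "(\<Xi>, j) \<in> ran T" "symbol_rule \<Sigma> S (\<Xi>, j)"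
    and es: "raw_instantiation \<Sigma> \<Theta> \<Gamma> \<Xi> es"
  shows "subject (map_jthesis (inst (instantiation_of \<Xi> es)) j) = Sym S es"
    and "natural_thesis \<Sigma> T \<Theta> \<Gamma> (map_jthesis (inst (instantiation_of \<Xi> es)) j)"
proof -
  from R(2) obtain \<beta> where \<beta>: "raw_mctx \<Sigma> \<Xi>" "object_bthesis \<beta>"
      "j = fill_thesis \<beta> (Sym S (map generic_arg \<Xi>))"
    by (auto simp: symbol_rule_def)
  have args: "inst (instantiation_of \<Xi> es) (Sym S (map generic_arg \<Xi>)) = Sym S es"
    using inst_generic_args[OF standard_theory_signature[OF std] \<beta>(1) es] by simp
  show "subject (map_jthesis (inst (instantiation_of \<Xi> es)) j) = Sym S es"
    using \<beta> args by (cases \<beta>) (simp_all del: inst.simps)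
  show "natural_thesis \<Sigma> T \<Theta> \<Gamma> (map_jthesis (inst (instantiation_of \<Xi> es)) j)"
    using \<beta> args the_symbol_rule[OF std R] by (cases \<beta>) (simp_all del: inst.simps)
qed

text \<open>Equation rules and congruences are excluded by \<open>object_jthesis j\<close>, which
  leaves variables, metavariables and symbol rules. \<open>c\<close> and \<open>Ds\<close> can be
  arbitrary because for these steps \<open>concludes_with\<close> inspects only the last
  rule.\<close>

lemma closure_inst_natural:
  assumes std: "standard_theory \<Sigma> T"
    and r: "closure_inst \<Sigma> T r ps (\<Theta>, \<Gamma>, Jdg (Thesis j))" "r \<noteq> Term_Conversion"
    and j: "object_jthesis j"
  shows "concludes_with \<Sigma> T (Infer r c Ds) (head_step (subject j)) \<and> natural_thesis \<Sigma> T \<Theta> \<Gamma> j"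
  using r(1)
proof cases
  case (metavariable M As \<beta> ts)
  \<comment> \<open>\<open>natural_type\<close> reads the thesis below the binders of the boundary
    stored in \<open>\<Theta>\<close>.\<close>
  have "thesis_of (foldr Bind As (Thesis \<beta>)) = \<beta>"
    by (induction As) auto
  with metavariable j show ?thesis
    by (cases \<beta>) (auto simp: subst_boundary_def)
next
  case (metavariable_cong M As \<beta> ss ts)
  with j show ?thesis
    by (cases \<beta>) (auto simp: subst_boundary_def)
next
  case (congruence \<Xi> \<beta> e fs gs I J)
  with j show ?thesis
    by (cases \<beta>) (auto simp: inst_boundary_def)
next
  case (instantiate \<Xi> \<beta> e es I)
  \<comment> \<open>Instantiation preserves the form of a thesis, so the specific rule is an object
    rule and hence a symbol rule.\<close>
  have "object_jthesis (fill_thesis \<beta> e)"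
    using j instantiate by (cases \<beta>) auto
  then obtain S where S: "symbol_rule \<Sigma> S (\<Xi>, fill_thesis \<beta> e)"
    using std instantiate by (fastforce simp: standard_theory_def)
  note inst = instantiate_symbol_rule[OF std _ S, of \<Theta> \<Gamma> es]
  show ?thesis
    using inst instantiate S by auto
qed (use j r(2) in auto)

section \<open>The final step as a function of the judgement: uniqueness\<close>

text \<open>The value depends on the judgement alone and not on a derivation, which is what makes
  the final step unique.\<close>

fun final_step_of ::
  "'s signature \<Rightarrow> ('i, 's) raw_theory \<Rightarrow> 's mctx \<Rightarrow> 's vctx \<Rightarrow> 's judgement \<Rightarrow> final_step" where
  "final_step_of \<Sigma> T \<Theta> \<Gamma> (Bind A J) = By_Abstraction"
| "final_step_of \<Sigma> T \<Theta> \<Gamma> (Thesis j) =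
     (if natural_thesis \<Sigma> T \<Theta> \<Gamma> j then head_step (subject j) else By_Natural_Conversion)"

text \<open>The five steps have pairwise different last rules, so below it is enough to exhibit one
  step with which a given derivation concludes.\<close>

lemma concludes_with_inject:
  assumes "concludes_with \<Sigma> T D k" "concludes_with \<Sigma> T D k'"
  shows "k = k'"
  using assms by (cases k; cases k') auto

lemma closure_inst_Bind:
  "closure_inst \<Sigma> T r ps (\<Theta>, \<Gamma>, Jdg (Bind A J)) \<Longrightarrow> r = Abstraction"
  by (erule closure_inst.cases) (auto simp: subst_boundary_def inst_boundary_def)

lemma concludes_with_final_step:
  assumes std: "standard_theory \<Sigma> T"
    and D: "derivation \<Sigma> T D" "conclusion D = (\<Theta>, \<Gamma>, Jdg J)"
    and J: "object_judgement J"
    and k: "concludes_with \<Sigma> T D k"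
  shows "k = final_step_of \<Sigma> T \<Theta> \<Gamma> J"
proof -
  from D obtain r Ds where D': "D = Infer r (\<Theta>, \<Gamma>, Jdg J) Ds"
      "closure_inst \<Sigma> T r (map conclusion Ds) (\<Theta>, \<Gamma>, Jdg J)"
    by (auto elim: derivation.cases)
  show ?thesis
  proof (cases J)
    case (Bind A J')
    then have "concludes_with \<Sigma> T D By_Abstraction"
      using D' closure_inst_Bind by fastforce
    with Bind show ?thesis
      using concludes_with_inject[OF k] by simp
  next
    case (Thesis j)
    show ?thesis
    proof (cases "r = Term_Conversion")
      case True
      \<comment> \<open>Here \<open>k\<close> can only be \<open>By_Natural_Conversion\<close>,
        whose side condition on the natural type is the failure of
        \<open>natural_thesis\<close>.\<close>
      then show ?thesis
        using k D' Thesis by (cases k) auto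
    next
      case False
      then have "concludes_with \<Sigma> T D (head_step (subject j))" "natural_thesis \<Sigma> T \<Theta> \<Gamma> j"
        using closure_inst_natural[OF std, of r "map conclusion Ds" \<Theta> \<Gamma> j] D' J Thesis
        by (auto simp: object_judgement_def)
      with Thesis show ?thesis
        using concludes_with_inject[OF k] by simp
    qed
  qed
qed

section \<open>Merging conversions: existence\<close>

text \<open>Induction over the derivation collapses successive conversions into one equation
  starting at the natural type. The disjunct \<open>\<tau> = A\<close> stands in for reflexivity,
  which would require a derivation that \<open>A\<close> is a type.\<close>

lemma derivable_natural_type:
  assumes std: "standard_theory \<Sigma> T"
    and "derivation \<Sigma> T D" "conclusion D = term_seq \<Theta> \<Gamma> t A"
  defines "\<tau> \<equiv> natural_type \<Sigma> T \<Theta> \<Gamma> t"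
  shows "(\<exists>D'. derivation \<Sigma> T D' \<and> conclusion D' = term_seq \<Theta> \<Gamma> t \<tau> \<and>
            concludes_with \<Sigma> T D' (head_step t)) \<and>
         (\<tau> = A \<or> derivable \<Sigma> T (eqtype_seq \<Theta> \<Gamma> \<tau> A))"
  using assms(2,3)
proof (induction arbitrary: A rule: derivation.induct)
  case (1 r Ds c)
  show ?case
  proof (cases "r = Term_Conversion")
    case True
    with 1 obtain B where "map conclusion Ds = [term_seq \<Theta> \<Gamma> t B, eqtype_seq \<Theta> \<Gamma> B A]"
      by (auto elim: closure_inst.cases)
    then obtain D1 D2 where Ds: "Ds = [D1, D2]" "conclusion D1 = term_seq \<Theta> \<Gamma> t B"
        "conclusion D2 = eqtype_seq \<Theta> \<Gamma> B A"
      by auto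
    then have IH: "\<exists>D'. derivation \<Sigma> T D' \<and> conclusion D' = term_seq \<Theta> \<Gamma> t \<tau> \<and>
            concludes_with \<Sigma> T D' (head_step t)"
        "\<tau> = B \<or> derivable \<Sigma> T (eqtype_seq \<Theta> \<Gamma> \<tau> B)"
      using 1(4)[of D1 B] by simp_all
    have BA: "derivable \<Sigma> T (eqtype_seq \<Theta> \<Gamma> B A)"
      using Ds 1(3)[of D2] by (auto simp: derivable_iff_derivation)
    have "derivable \<Sigma> T (eqtype_seq \<Theta> \<Gamma> \<tau> A)"
      using IH(2)
    proof
      assume \<tau>B: "derivable \<Sigma> T (eqtype_seq \<Theta> \<Gamma> \<tau> B)"
      \<comment> \<open>Each of the two raw sequents supplies one side of the composed equation,
        which is therefore well-formed.\<close>
      show ?thesis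
        using derivable.intros[OF closure_inst.type_trans] \<tau>B BA
          derivable_raw_sequent[OF \<tau>B] derivable_raw_sequent[OF BA] by fastforce
    qed (use BA in simp)
    with IH(1) show ?thesis
      by blast
  next
    case False
    with 1 closure_inst_natural[OF std, of r "map conclusion Ds" \<Theta> \<Gamma> "IsTerm t A" c Ds]
    have nat: "concludes_with \<Sigma> T (Infer r c Ds) (head_step t)" "\<tau> = A"
      by (simp_all add: \<tau>_def)
    moreover have "derivation \<Sigma> T (Infer r c Ds)"
      using 1 by (intro derivation.intros)
    ultimately show ?thesis
      using 1(5) by (intro conjI exI[of _ "Infer r c Ds"]) auto
  qed
qed

lemma exists_derivation_final_step:
  assumes std: "standard_theory \<Sigma> T"
    and der: "derivable \<Sigma> T (\<Theta>, \<Gamma>, Jdg J)"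
    and J: "object_judgement J"
  shows "\<exists>D. derivation \<Sigma> T D \<and> conclusion D = (\<Theta>, \<Gamma>, Jdg J) \<and>
           concludes_with \<Sigma> T D (final_step_of \<Sigma> T \<Theta> \<Gamma> J)"
proof -
  from der obtain D where D: "derivation \<Sigma> T D" "conclusion D = (\<Theta>, \<Gamma>, Jdg J)"
    by (auto simp: derivable_iff_derivation)
  then obtain r Ds where D': "D = Infer r (\<Theta>, \<Gamma>, Jdg J) Ds"
      "closure_inst \<Sigma> T r (map conclusion Ds) (\<Theta>, \<Gamma>, Jdg J)"
    by (auto elim: derivation.cases)
  consider (bind) A J' where "J = Bind A J'" | (type) A where "J = Thesis (IsType A)"
    | (conv) t A where "J = Thesis (IsTerm t A)"
    using J by (cases J rule: thesis_of.cases; cases "thesis_of J") (auto simp: object_judgement_def)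
  then show ?thesis
  proof cases
    case bind
    then have "concludes_with \<Sigma> T D By_Abstraction"
      using D' closure_inst_Bind by fastforce
    with D bind show ?thesis
      by auto
  next
    case type
    then have "r \<noteq> Term_Conversion"
      using D'(2) by (auto elim: closure_inst.cases)
    with D' type have "concludes_with \<Sigma> T D (head_step A)"
      using closure_inst_natural[OF std, of r "map conclusion Ds" \<Theta> \<Gamma> "IsType A"] by simp
    with D type show ?thesis
      by auto
  next
    case conv
    let ?\<tau> = "natural_type \<Sigma> T \<Theta> \<Gamma> t"
    from derivable_natural_type[OF std D(1), of \<Theta> \<Gamma> t A] D(2) conv
    obtain D1 where D1: "derivation \<Sigma> T D1" "conclusion D1 = term_seq \<Theta> \<Gamma> t ?\<tau>"
        "concludes_with \<Sigma> T D1 (head_step t)"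
      and eq: "?\<tau> = A \<or> derivable \<Sigma> T (eqtype_seq \<Theta> \<Gamma> ?\<tau> A)"
      by auto
    show ?thesis
    proof (cases "?\<tau> = A")
      \<comment> \<open>\<open>D1\<close> already derives the judgement, so no conversion is
        left.\<close>
      case True
      with D1 conv show ?thesis
        by auto
    next
      case False
      with eq obtain D2 where D2: "derivation \<Sigma> T D2" "conclusion D2 = eqtype_seq \<Theta> \<Gamma> ?\<tau> A"
        by (auto simp: derivable_iff_derivation)
      let ?D = "Infer Term_Conversion (\<Theta>, \<Gamma>, Jdg J) [D1, D2]"
      have "derivation \<Sigma> T ?D"
        using D1 D2 conv derivable_raw_sequent[OF der]
        by (intro derivation.intros) (auto intro: closure_inst.term_conversion)
      moreover have "concludes_with \<Sigma> T ?D By_Natural_Conversion"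
        using D1 D2 conv False by simp
      ultimately show ?thesis
        using conv False by (intro exI[of _ ?D]) simp
    qed
  qed
qed

theorem mainTheorem7:
  fixes \<Sigma> :: "'s signature" and T :: "('i, 's) raw_theory"
    and \<Theta> :: "'s mctx" and \<Gamma> :: "'s vctx" and J :: "'s judgement"
  assumes "standard_theory \<Sigma> T"
    and "derivable \<Sigma> T (\<Theta>, \<Gamma>, Jdg J)"
    and "object_judgement J"
  shows "\<exists>!k. \<exists>D. derivation \<Sigma> T D \<and> conclusion D = (\<Theta>, \<Gamma>, Jdg J) \<and> concludes_with \<Sigma> T D k"
proof (rule ex1I)
  show "\<exists>D. derivation \<Sigma> T D \<and> conclusion D = (\<Theta>, \<Gamma>, Jdg J) \<and>
          concludes_with \<Sigma> T D (final_step_of \<Sigma> T \<Theta> \<Gamma> J)"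
    using exists_derivation_final_step[OF assms] .
  show "k = final_step_of \<Sigma> T \<Theta> \<Gamma> J"
    if "\<exists>D. derivation \<Sigma> T D \<and> conclusion D = (\<Theta>, \<Gamma>, Jdg J) \<and> concludes_with \<Sigma> T D k" for k
    using that concludes_with_final_step assms(1,3) by metis
qed

end
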